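(* Let $f_n^{(p,q)}$ be the number of $n$-TITOs avoiding both $p$ and $q$, and let $\mathcal{F}^{(p,q)}(x)=\sum_{n\ge 0} f_n^{(p,q)}x^n$ (with $f_0^{(p,q)}=0$). For distinct patterns $p,q\in S_3$ the values for $n\ge 1$ and the generating functions are as follows: (a) if $\{p,q\}$ is one of $\{312,123\},\{213,321\},\{132,321\},\{231,123\}$, then $f_n^{(p,q)}=1$ and $\mathcal{F}^{(p,q)}(x)=\frac{x}{1-x}$; (b) if $\{p,q\}$ is one of $\{312,132\},\{213,231\}$, then $f_n^{(p,q)}=2$ and $\mathcal{F}^{(p,q)}(x)=\frac{2x}{1-x}$; (c) if $\{p,q\}$ is one of $\{312,231\},\{213,132\},\{312,213\},\{132,231\}$, then $f_n^{(p,q)}=2^n$ and $\mathcal{F}^{(p,q)}(x)=\frac{2x}{1-2x}$; (d) if $\{p,q\}$ is one of $\{312,321\},\{213,123\},\{132,123\},\{231,321\}$, then $f_n^{(p,q)}=2^n-1$ and $\mathcal{F}^{(p,q)}(x)=\frac{x}{(1-2x)(1-x)}$; (e) if $\{p,q\}=\{123,321\}$, then $f_n^{(p,q)}=0$ and $\mathcal{F}^{(p,q)}(x)=0$.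
   Context: For a positive integer $n$, a translation-invariant total order with period $n$ ($n$-TITO) is a total order $\preceq$ of $\mathbb{Z}$ such that for all $a,b\in\mathbb{Z}$, $a\preceq b$ if and only if $a+n\preceq b+n$. An $n$-TITO $\preceq$ avoids a pattern $p=p_1\cdots p_k\in S_k$ (one-line notation) if there are no integers $i_1<\cdots<i_k$ with $i_{p_1}\preceq i_{p_2}\preceq\cdots\preceq i_{p_k}$. For instance, $a<b<c$ form a $312$-pattern if $c\preceq a\preceq b$. Convention: $f_0^{(p,q)}=0$. *)

theory Defs
  imports
    "HOL-Combinatorics.Multiset_Permutations"
    "HOL-Computational_Algebra.Formal_Power_Series"
begin

definition is_tito :: "nat \<Rightarrow> int rel \<Rightarrow> bool" where
  "is_tito n r \<longleftrightarrow>
     linear_order r \<and> (\<forall>a b. (a, b) \<in> r \<longleftrightarrow> (a + int n, b + int n) \<in> r)"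

text \<open>
  A pattern in \<open>S\<^sub>k\<close> is the list of its one-line notation, an element of
  \<open>permutations_of_set {1..k}\<close>. Integers \<open>i\<^sub>1 < \<dots> < i\<^sub>k\<close> are the values on \<open>{1..k}\<close> of a
  function \<open>i\<close> strictly increasing there; values elsewhere are irrelevant.
\<close>

definition avoids :: "int rel \<Rightarrow> nat list \<Rightarrow> bool" where
  "avoids r p \<longleftrightarrow>
     \<not> (\<exists>i :: nat \<Rightarrow> int. strict_mono_on {1..length p} i \<and>
          successively (\<lambda>a b. (a, b) \<in> r) (map i p))"

definition avoiding_titos :: "nat list \<Rightarrow> nat list \<Rightarrow> nat \<Rightarrow> int rel set" where
  "avoiding_titos p q n = {r. is_tito n r \<and> avoids r p \<and> avoids r q}"

text \<open>
  The period of a TITO is positive; the value at \<open>0\<close> is a convention. As \<open>card\<close> is \<open>0\<close> on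
  infinite sets, statements about \<open>num_avoiding\<close> should come with finiteness of
  \<open>avoiding_titos p q n\<close>.
\<close>

definition num_avoiding :: "nat list \<Rightarrow> nat list \<Rightarrow> nat \<Rightarrow> nat" where
  "num_avoiding p q n = (if n = 0 then 0 else card (avoiding_titos p q n))"

definition gf_avoiding :: "nat list \<Rightarrow> nat list \<Rightarrow> rat fps" where
  "gf_avoiding p q = Abs_fps (\<lambda>n. of_nat (num_avoiding p q n))"

end

theory Submission
  imports Defs
begin

text \<open>
  A total order of the integers is determined by its inversions, the pairs \<open>a < b\<close> with \<open>b\<close> placed
  before \<open>a\<close>. A relation \<open>I\<close> on pairs \<open>a < b\<close> is the inversion relation of a total order exactly if
  \<open>I\<close> and its complement are both transitive, and the order is a TITO exactly if \<open>I\<close> is invariant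
  under translation by \<open>n\<close>. For \<open>a < b < c\<close>, avoiding a pattern of length 3 says something about two of
  the three pairs: avoiding 312, for example, says that \<open>I a c\<close> implies \<open>I a b\<close>.

  Reversing the order and reflecting the integers at \<open>0\<close> send TITOs to TITOs; they reverse and
  complement patterns. Under these two symmetries the fifteen pairs of patterns fall into six orbits.
  Each orbit has a representative whose inversion relations can be written down:

  \<^item> 123 and 321: one of \<open>I 0 n\<close> and \<open>I n (2 n)\<close> would have to hold and the other to fail, against
    periodicity; there is no such TITO.
  \<^item> 312 and 123: avoiding 123 makes \<open>a\<close> and \<open>a + k n\<close> an inversion for all \<open>k > 0\<close>, and 312 passes this
    on to all pairs below; the only such TITO is the decreasing order.
  \<^item> 312 and 132: one inversion, moved far to the right by a period, forces all pairs to its left to be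
    inversions; only the increasing and the decreasing order remain.
  \<^item> 312 and 213: \<open>I a b\<close> does not depend on \<open>b\<close>, so it says that \<open>a\<close> is a descent.
  \<^item> 312 and 231: \<open>I a b\<close> says that all of \<open>a, \<dots>, b - 1\<close> are descents.
  \<^item> 312 and 321: let \<open>T\<close> be the set of integers preceded by all smaller ones. Then \<open>I a b\<close> says that \<open>a\<close>
    is the greatest element of \<open>T\<close> up to \<open>b\<close>, and \<open>b\<close> is not in \<open>T\<close>.

  In the fourth and fifth case every \<open>n\<close>-periodic set is the set of descents of exactly one TITO, in
  the sixth every nonempty \<open>n\<close>-periodic set is \<open>T\<close> for exactly one TITO. There are \<open>2\<^sup>n\<close> periodic sets,
  as such a set is determined by the residues in it. The generating functions are geometric series.
\<close>

section \<open>Total orders of the integers and their inversions\<close>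

definition inversion :: "int rel \<Rightarrow> int \<Rightarrow> int \<Rightarrow> bool" where
  "inversion r a b \<longleftrightarrow> a < b \<and> (b, a) \<in> r"

definition order_of :: "(int \<Rightarrow> int \<Rightarrow> bool) \<Rightarrow> int rel" where
  "order_of I = {(a, b). a = b \<or> (a < b \<and> \<not> I a b) \<or> (b < a \<and> I b a)}"

lemma inversion_order_of: "inversion (order_of I) a b \<longleftrightarrow> a < b \<and> I a b"
  by (auto simp: inversion_def order_of_def)

lemma linear_order_iff_not_inversion:
  assumes "linear_order r" "a < b"
  shows "(a, b) \<in> r \<longleftrightarrow> \<not> inversion r a b"
proof -
  have "(a, b) \<in> r \<or> (b, a) \<in> r" "(a, b) \<in> r \<Longrightarrow> (b, a) \<notin> r"
    using assms by (auto simp: linear_order_on_def partial_order_on_def total_on_def antisym_def)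
  with assms(2) show ?thesis by (auto simp: inversion_def)
qed

lemma order_of_inversions:
  assumes "linear_order r" "\<And>a b. a < b \<Longrightarrow> inversion r a b \<longleftrightarrow> I a b"
  shows "order_of I = r"
proof -
  have "(a, a) \<in> r" for a
    using assms(1) by (auto simp: linear_order_on_def partial_order_on_def preorder_on_def refl_on_def)
  then have "(a, b) \<in> order_of I \<longleftrightarrow> (a, b) \<in> r" for a b
    using assms(2)[of a b] assms(2)[of b a] linear_order_iff_not_inversion[OF assms(1), of a b]
    by (cases a b rule: linorder_cases) (auto simp: order_of_def inversion_def)
  then show ?thesis by auto
qed

text \<open>
  Among three integers with prescribed inversions, the order can fail to be transitive only by being
  cyclic. For \<open>a < b < c\<close> the two cyclic arrangements are \<open>I a b\<close>, \<open>I b c\<close> without \<open>I a c\<close>, and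
  \<open>I a c\<close> without \<open>I a b\<close> and \<open>I b c\<close>.
\<close>
lemma linear_order_order_of:
  assumes trans: "\<And>a b c. a < b \<Longrightarrow> b < c \<Longrightarrow> I a b \<Longrightarrow> I b c \<Longrightarrow> I a c"
    and cotrans: "\<And>a b c. a < b \<Longrightarrow> b < c \<Longrightarrow> I a c \<Longrightarrow> I a b \<or> I b c"
  shows "linear_order (order_of I)"
proof -
  have "(a, c) \<in> order_of I" if "(a, b) \<in> order_of I" "(b, c) \<in> order_of I" for a b c
    using that unfolding order_of_def mem_Collect_eq prod.case
    by (smt (verit, ccfv_threshold) trans cotrans)
  then have "trans (order_of I)"
    by (rule transI)
  moreover have "refl (order_of I)" "antisym (order_of I)" "total (order_of I)"
    by (auto simp: order_of_def refl_on_def antisym_def total_on_def)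
  ultimately show ?thesis
    by (simp add: linear_order_on_def partial_order_on_def preorder_on_def)
qed

lemma is_tito_order_of:
  assumes "\<And>a b c. a < b \<Longrightarrow> b < c \<Longrightarrow> I a b \<Longrightarrow> I b c \<Longrightarrow> I a c"
    and "\<And>a b c. a < b \<Longrightarrow> b < c \<Longrightarrow> I a c \<Longrightarrow> I a b \<or> I b c"
    and "\<And>a b. I (a + int n) (b + int n) \<longleftrightarrow> I a b"
  shows "is_tito n (order_of I)"
proof -
  have "linear_order (order_of I)"
    using assms(1,2) by (rule linear_order_order_of)
  with assms(3) show ?thesis
    by (simp add: is_tito_def order_of_def)
qed

lemma inversion_trans:
  assumes "linear_order r" "inversion r a b" "inversion r b c"
  shows "inversion r a c"
proof -
  have "trans r"
    using assms(1) by (simp add: linear_order_on_def partial_order_on_def preorder_on_def)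
  with assms(2,3) show ?thesis
    unfolding inversion_def by (meson less_trans transD)
qed

lemma inversion_translate:
  "is_tito n r \<Longrightarrow> inversion r (a + int n) (b + int n) \<longleftrightarrow> inversion r a b"
  by (auto simp: is_tito_def inversion_def)

section \<open>Patterns of length three in terms of inversions\<close>

definition avoiders :: "nat list set \<Rightarrow> nat \<Rightarrow> int rel set" where
  "avoiders P n = {r. is_tito n r \<and> (\<forall>p\<in>P. avoids r p)}"

text \<open>
  An occurrence is determined by the values \<open>i 1 < i 2 < i 3\<close>, so the quantifier over functions can be
  replaced by one over three integers. The list \<open>[a, b, c] ! (j - 1)\<close> is the function with \<open>i 1 = a\<close>,
  \<open>i 2 = b\<close> and \<open>i 3 = c\<close>.
\<close>
lemma avoids_length_3_iff:
  assumes "set p \<subseteq> {1..3}" "length p = 3"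
  shows "avoids r p \<longleftrightarrow> (\<forall>a b c. a < b \<longrightarrow> b < c \<longrightarrow>
    \<not> successively (\<lambda>x y. (x, y) \<in> r) (map (\<lambda>j. [a, b, c] ! (j - 1)) p))"
proof -
  have three: "{1..3} = {1, 2, 3::nat}" by auto
  have eq: "map i p = map (\<lambda>j. [i 1, i 2, i 3] ! (j - 1)) p" for i :: "nat \<Rightarrow> int"
    using assms(1) unfolding three by (intro map_cong) auto
  have mono: "strict_mono_on {1..3} i \<longleftrightarrow> i 1 < i 2 \<and> i 2 < i 3" for i :: "nat \<Rightarrow> int"
    unfolding three by (auto simp: strict_mono_on_def)
  show ?thesis
    unfolding avoids_def assms(2)
  proof (intro iffI allI impI notI)
    fix a b c :: int
    assume "\<nexists>i. strict_mono_on {1..3} i \<and> successively (\<lambda>a b. (a, b) \<in> r) (map i p)"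
    moreover assume "a < b" "b < c"
    then have "strict_mono_on {1..3} (\<lambda>j. [a, b, c] ! (j - 1))"
      unfolding mono by simp
    moreover assume "successively (\<lambda>x y. (x, y) \<in> r) (map (\<lambda>j. [a, b, c] ! (j - 1)) p)"
    ultimately show False by blast
  next
    assume none: "\<forall>a b c. a < b \<longrightarrow> b < c \<longrightarrow>
      \<not> successively (\<lambda>x y. (x, y) \<in> r) (map (\<lambda>j. [a, b, c] ! (j - 1)) p)"
    assume "\<exists>i. strict_mono_on {1..3} i \<and> successively (\<lambda>a b. (a, b) \<in> r) (map i p)"
    then obtain i where i: "i 1 < i 2" "i 2 < i 3" "successively (\<lambda>a b. (a, b) \<in> r) (map i p)"
      unfolding mono by blast
    then show False
      using none[rule_format, OF i(1,2)] eq[of i] by simp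
  qed
qed

text \<open>
  The two relations required by an occurrence are statements about the pairs of neighbouring letters
  only; each becomes an inversion or its negation, according to whether the letters decrease or
  increase.
\<close>
lemma avoids_iff_inversion:
  assumes "linear_order r"
  shows "avoids r [1,2,3] \<longleftrightarrow> (\<forall>a b c. a < b \<longrightarrow> b < c \<longrightarrow> inversion r a b \<or> inversion r b c)"
    and "avoids r [1,3,2] \<longleftrightarrow> (\<forall>a b c. a < b \<longrightarrow> b < c \<longrightarrow> inversion r b c \<longrightarrow> inversion r a c)"
    and "avoids r [2,1,3] \<longleftrightarrow> (\<forall>a b c. a < b \<longrightarrow> b < c \<longrightarrow> inversion r a b \<longrightarrow> inversion r a c)"
    and "avoids r [2,3,1] \<longleftrightarrow> (\<forall>a b c. a < b \<longrightarrow> b < c \<longrightarrow> inversion r a c \<longrightarrow> inversion r b c)"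
    and "avoids r [3,1,2] \<longleftrightarrow> (\<forall>a b c. a < b \<longrightarrow> b < c \<longrightarrow> inversion r a c \<longrightarrow> inversion r a b)"
    and "avoids r [3,2,1] \<longleftrightarrow> (\<forall>a b c. a < b \<longrightarrow> b < c \<longrightarrow> inversion r a b \<longrightarrow> \<not> inversion r b c)"
proof -
  have asc: "(a, b) \<in> r \<longleftrightarrow> \<not> inversion r a b" and desc: "(b, a) \<in> r \<longleftrightarrow> inversion r a b"
    if "a < b" for a b
    using linear_order_iff_not_inversion[OF assms that] that by (auto simp: inversion_def)
  have less_trans': "a < b \<Longrightarrow> b < c \<Longrightarrow> a < c" for a b c :: int by simp
  show "avoids r [1,2,3] \<longleftrightarrow> (\<forall>a b c. a < b \<longrightarrow> b < c \<longrightarrow> inversion r a b \<or> inversion r b c)"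
    by (subst avoids_length_3_iff) (simp_all, meson asc desc less_trans')
  show "avoids r [1,3,2] \<longleftrightarrow> (\<forall>a b c. a < b \<longrightarrow> b < c \<longrightarrow> inversion r b c \<longrightarrow> inversion r a c)"
    by (subst avoids_length_3_iff) (simp_all, meson asc desc less_trans')
  show "avoids r [2,1,3] \<longleftrightarrow> (\<forall>a b c. a < b \<longrightarrow> b < c \<longrightarrow> inversion r a b \<longrightarrow> inversion r a c)"
    by (subst avoids_length_3_iff) (simp_all, meson asc desc less_trans')
  show "avoids r [2,3,1] \<longleftrightarrow> (\<forall>a b c. a < b \<longrightarrow> b < c \<longrightarrow> inversion r a c \<longrightarrow> inversion r b c)"
    by (subst avoids_length_3_iff) (simp_all, meson asc desc less_trans')
  show "avoids r [3,1,2] \<longleftrightarrow> (\<forall>a b c. a < b \<longrightarrow> b < c \<longrightarrow> inversion r a c \<longrightarrow> inversion r a b)"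
    by (subst avoids_length_3_iff) (simp_all, meson asc desc less_trans')
  show "avoids r [3,2,1] \<longleftrightarrow> (\<forall>a b c. a < b \<longrightarrow> b < c \<longrightarrow> inversion r a b \<longrightarrow> \<not> inversion r b c)"
    by (subst avoids_length_3_iff) (simp_all, meson asc desc less_trans')
qed

section \<open>Reversal and complement\<close>

definition reflect :: "int rel \<Rightarrow> int rel" where
  "reflect r = {(a, b). (- a, - b) \<in> r}"

definition complement :: "nat list \<Rightarrow> nat list" where
  "complement p = map (\<lambda>j. Suc (length p) - j) p"

lemma avoids_converse: "avoids (r\<inverse>) p \<longleftrightarrow> avoids r (rev p)"
  by (simp add: avoids_def successively_rev flip: rev_map)

lemma is_tito_converse: "is_tito n r \<Longrightarrow> is_tito n (r\<inverse>)"
  by (auto simp: is_tito_def)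

lemma is_tito_reflect:
  assumes "is_tito n r"
  shows "is_tito n (reflect r)"
proof -
  have "linear_order (reflect r)"
    using assms unfolding is_tito_def linear_order_on_def partial_order_on_def preorder_on_def
    by (auto simp: reflect_def refl_on_def total_on_def intro!: transI antisymI
        dest: transD antisymD)
  moreover have "(- a, - b) \<in> r \<longleftrightarrow> (- (a + int n), - (b + int n)) \<in> r" for a b
    using assms[unfolded is_tito_def, THEN conjunct2, rule_format, of "- (a + int n)" "- (b + int n)"]
    by simp
  ultimately show ?thesis
    unfolding is_tito_def by (auto simp only: reflect_def mem_Collect_eq prod.case)
qed

text \<open>
  Negation reverses the order of the integers, so an occurrence \<open>i\<close> of a pattern in the reflected order
  gives the occurrence \<open>j \<mapsto> - i (k + 1 - j)\<close> of the complement in the original one, where \<open>k\<close> is the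
  length of the pattern. The converse follows as both operations are involutions.
\<close>
lemma avoids_reflect_imp:
  assumes "avoids r (complement p)" "set p \<subseteq> {1..length p}"
  shows "avoids (reflect r) p"
  unfolding avoids_def
proof clarify
  fix i :: "nat \<Rightarrow> int"
  assume i: "strict_mono_on {1..length p} i"
    and occ: "successively (\<lambda>a b. (a, b) \<in> reflect r) (map i p)"
  define i' where "i' = (\<lambda>j. - i (Suc (length p) - j))"
  have "strict_mono_on {1..length p} i'"
    unfolding i'_def by (intro strict_mono_onI) (auto intro!: strict_mono_onD[OF i])
  moreover have "map i' (complement p) = map (\<lambda>j. - i j) p"
    using assms(2) by (auto simp: i'_def complement_def subset_iff)
  then have "successively (\<lambda>a b. (a, b) \<in> r) (map i' (complement p))"
    using occ by (simp add: successively_map reflect_def)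
  ultimately show False
    using assms(1) by (auto simp: avoids_def complement_def)
qed

lemma reflect_reflect [simp]: "reflect (reflect r) = r"
  by (auto simp: reflect_def)

lemma complement_complement:
  "set p \<subseteq> {1..length p} \<Longrightarrow> complement (complement p) = p"
  by (auto simp: complement_def subset_iff intro!: map_idI)

lemma set_complement:
  "set p \<subseteq> {1..length p} \<Longrightarrow> set (complement p) \<subseteq> {1..length (complement p)}"
  by (auto simp: complement_def subset_iff)

lemma avoids_reflect:
  assumes "set p \<subseteq> {1..length p}"
  shows "avoids (reflect r) p \<longleftrightarrow> avoids r (complement p)"
  using avoids_reflect_imp[OF _ set_complement[OF assms], of "reflect r"]
    avoids_reflect_imp[OF _ assms, of r]
  by (auto simp: complement_complement[OF assms])

text \<open>
  The patterns form a set so that the symmetries act by images and the order of the two patterns is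
  immaterial. Finiteness is included because \<open>card\<close> of an infinite set
  is \<open>0\<close>.
\<close>
definition counted_by :: "nat list set \<Rightarrow> (nat \<Rightarrow> nat) \<Rightarrow> bool" where
  "counted_by P f \<longleftrightarrow> (\<forall>n\<ge>1. finite (avoiders P n) \<and> card (avoiders P n) = f n)"

lemma counted_by_bij_betw:
  assumes "counted_by P f" "\<And>n. bij_betw g (avoiders P n) (avoiders Q n)"
  shows "counted_by Q f"
  using assms(1) bij_betw_finite[OF assms(2)] bij_betw_same_card[OF assms(2)]
  by (simp add: counted_by_def)

lemma counted_by_rev:
  assumes "counted_by P f"
  shows "counted_by (rev ` P) f"
proof (rule counted_by_bij_betw[OF assms])
  show "bij_betw converse (avoiders P n) (avoiders (rev ` P) n)" for n
    by (rule bij_betw_byWitness[where f' = converse])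
      (auto simp: avoiders_def avoids_converse is_tito_converse)
qed

lemma counted_by_complement:
  assumes "counted_by P f" and letters: "\<And>p. p \<in> P \<Longrightarrow> set p \<subseteq> {1..length p}"
  shows "counted_by (complement ` P) f"
proof (rule counted_by_bij_betw[OF assms(1)])
  fix n
  have "avoids (reflect r) (complement p) \<longleftrightarrow> avoids r p" if "p \<in> P" for p r
    using avoids_reflect[OF set_complement[OF letters[OF that]]]
    by (simp add: complement_complement[OF letters[OF that]])
  moreover have "avoids (reflect r) p \<longleftrightarrow> avoids r (complement p)" if "p \<in> P" for p r
    using avoids_reflect[OF letters[OF that]] .
  ultimately show "bij_betw reflect (avoiders P n) (avoiders (complement ` P) n)"
    by (intro bij_betw_byWitness[where f' = reflect])
      (auto simp: avoiders_def is_tito_reflect)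
qed

section \<open>Periodicity\<close>

definition periodic_sets :: "nat \<Rightarrow> int set set" where
  "periodic_sets n = {S. \<forall>a. a + int n \<in> S \<longleftrightarrow> a \<in> S}"

lemma periodic_shift:
  assumes "S \<in> periodic_sets n"
  shows "a + int n * k \<in> S \<longleftrightarrow> a \<in> S"
proof (induction k arbitrary: a rule: int_induct[where k = 0])
  case base
  then show ?case by simp
next
  case (step1 k)
  show ?case
    using step1.IH[of "a + int n"] assms by (simp add: periodic_sets_def algebra_simps)
next
  case (step2 k)
  have "a - int n \<in> S \<longleftrightarrow> a \<in> S"
    using assms unfolding periodic_sets_def mem_Collect_eq by (metis diff_add_cancel)
  then show ?case
    using step2.IH[of "a - int n"] by (simp add: algebra_simps)
qed

lemma card_periodic_sets:
  assumes "n \<ge> 1"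
  shows "finite (periodic_sets n)" "card (periodic_sets n) = 2 ^ n"
proof -
  have "bij_betw (\<lambda>S. S \<inter> {0..<int n}) (periodic_sets n) (Pow {0..<int n})"
  proof (rule bij_betw_byWitness[where f' = "\<lambda>X. {a. a mod int n \<in> X}"])
    show "\<forall>S\<in>periodic_sets n. {a. a mod int n \<in> S \<inter> {0..<int n}} = S"
    proof
      fix S assume "S \<in> periodic_sets n"
      from periodic_shift[OF this, of "a mod int n" "a div int n" for a]
      show "{a. a mod int n \<in> S \<inter> {0..<int n}} = S"
        using assms by (auto simp: mod_mult_div_eq)
    qed
    show "\<forall>X\<in>Pow {0..<int n}. {a. a mod int n \<in> X} \<inter> {0..<int n} = X"
      using assms by auto
  qed (auto simp: periodic_sets_def)
  then show "finite (periodic_sets n)" "card (periodic_sets n) = 2 ^ n"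
    using assms by (auto simp: bij_betw_finite bij_betw_same_card card_Pow)
qed

text \<open>
  For a fixed distance \<open>b - a\<close>, the left ends of inversions with that distance form a periodic set.
\<close>
lemma inversion_shift:
  assumes "is_tito n r"
  shows "inversion r (a + int n * k) (b + int n * k) \<longleftrightarrow> inversion r a b"
proof -
  have "inversion r (x + int n) (x + int n + (b - a)) \<longleftrightarrow> inversion r x (x + (b - a))" for x
    using inversion_translate[OF assms, of x "x + (b - a)"] by (simp add: algebra_simps)
  then have "{x. inversion r x (x + (b - a))} \<in> periodic_sets n"
    by (simp add: periodic_sets_def)
  from periodic_shift[OF this, of a k] show ?thesis
    by (simp add: algebra_simps)
qed

text \<open>
  Any pair can be moved to the right of any given integer by a multiple of the period. This is how a
  local condition on an order acquires consequences for all pairs.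
\<close>
lemma exists_shift_above:
  assumes "n \<ge> 1"
  obtains k where "a + int n * k > b"
proof
  define k where "k = \<bar>b - a\<bar> + 1"
  have "1 * k \<le> int n * k"
    using assms by (intro mult_right_mono) (auto simp: k_def)
  moreover have "b - a < k" by (simp add: k_def)
  ultimately show "a + int n * k > b" by linarith
qed

lemma is_tito_linear_order: "is_tito n r \<Longrightarrow> linear_order r"
  by (simp add: is_tito_def)

lemma avoiders_pair:
  "r \<in> avoiders {p, q} n \<longleftrightarrow> is_tito n r \<and> avoids r p \<and> avoids r q"
  by (simp add: avoiders_def)

lemmas avoids_tito = avoids_iff_inversion[OF is_tito_linear_order]

definition descents :: "int rel \<Rightarrow> int set" where
  "descents r = {a. inversion r a (a + 1)}"

lemma descents_periodic:
  assumes "is_tito n r"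
  shows "descents r \<in> periodic_sets n"
proof -
  have "inversion r (a + int n) (a + int n + 1) \<longleftrightarrow> inversion r a (a + 1)" for a
    using inversion_translate[OF assms, of a "a + 1"] by (simp add: algebra_simps)
  then show ?thesis by (simp add: descents_def periodic_sets_def)
qed

text \<open>
  The common form of the two families with \<open>2\<^sup>n\<close> members: \<open>F\<close> rebuilds an avoider from its set of
  descents.
\<close>
lemma counted_by_periodic_sets:
  assumes "\<And>n S. n \<ge> 1 \<Longrightarrow> S \<in> periodic_sets n \<Longrightarrow> F S \<in> avoiders P n"
    and "\<And>S. descents (F S) = S"
    and "\<And>n r. n \<ge> 1 \<Longrightarrow> r \<in> avoiders P n \<Longrightarrow> F (descents r) = r"
  shows "counted_by P (\<lambda>n. 2 ^ n)"
  unfolding counted_by_def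
proof (intro allI impI)
  fix n :: nat assume n: "n \<ge> 1"
  have "bij_betw F (periodic_sets n) (avoiders P n)"
    using assms n
    by (intro bij_betw_byWitness[where f' = descents]) (auto simp: avoiders_def descents_periodic)
  from bij_betw_finite[OF this] bij_betw_same_card[OF this]
  show "finite (avoiders P n) \<and> card (avoiders P n) = 2 ^ n"
    using card_periodic_sets[OF n] by simp
qed

section \<open>Pairs of patterns with a bounded number of avoiders\<close>

lemma counted_by_123_321: "counted_by {[1,2,3], [3,2,1]} (\<lambda>_. 0)"
proof -
  have "r \<notin> avoiders {[1,2,3], [3,2,1]} n" if n: "n \<ge> 1" for n r
  proof
    assume "r \<in> avoiders {[1,2,3], [3,2,1]} n"
    then have tito: "is_tito n r" and "avoids r [1,2,3]" "avoids r [3,2,1]"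
      by (simp_all add: avoiders_pair)
    then have 123: "\<And>a b c. a < b \<Longrightarrow> b < c \<Longrightarrow> inversion r a b \<or> inversion r b c"
      and 321: "\<And>a b c. a < b \<Longrightarrow> b < c \<Longrightarrow> inversion r a b \<Longrightarrow> \<not> inversion r b c"
      unfolding avoids_tito[OF tito] by blast+
    have "inversion r 0 (int n) \<longleftrightarrow> \<not> inversion r (int n) (int n + int n)"
      using 123[of 0 "int n" "int n + int n"] 321[of 0 "int n" "int n + int n"] n by auto
    then show False
      using inversion_translate[OF tito, of 0 "int n"] by simp
  qed
  then have "avoiders {[1,2,3], [3,2,1]} n = {}" if "n \<ge> 1" for n
    using that by blast
  then show ?thesis by (simp add: counted_by_def del: One_nat_def)
qed

text \<open>
  By periodicity the pairs \<open>(a, a + k n)\<close> and \<open>(a + k n, a + 2 k n)\<close> are both inversions or both not, and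
  avoiding 123 excludes the latter. Given \<open>b > a\<close>, choose \<open>k\<close> with \<open>a + k n > b\<close>; avoiding 312 then
  makes \<open>(a, b)\<close> an inversion.
\<close>
lemma counted_by_312_123: "counted_by {[3,1,2], [1,2,3]} (\<lambda>_. 1)"
proof -
  let ?D = "order_of (\<lambda>_ _. True)"
  have "avoiders {[3,1,2], [1,2,3]} n = {?D}" if n: "n \<ge> 1" for n
  proof (intro equalityI subsetI)
    fix r assume "r \<in> avoiders {[3,1,2], [1,2,3]} n"
    then have tito: "is_tito n r" and "avoids r [3,1,2]" "avoids r [1,2,3]"
      by (simp_all add: avoiders_pair)
    then have 312: "\<And>a b c. a < b \<Longrightarrow> b < c \<Longrightarrow> inversion r a c \<Longrightarrow> inversion r a b"
      and 123: "\<And>a b c. a < b \<Longrightarrow> b < c \<Longrightarrow> inversion r a b \<or> inversion r b c"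
      unfolding avoids_tito[OF tito] by blast+
    have "inversion r a b" if "a < b" for a b
    proof -
      obtain k where k: "a + int n * k > b"
        using exists_shift_above[OF n] by blast
      have "inversion r a (a + int n * k) \<or> inversion r (a + int n * k) (a + int n * k + int n * k)"
        using k that 123[of a "a + int n * k" "a + int n * k + int n * k"] by linarith
      then have "inversion r a (a + int n * k)"
        using inversion_shift[OF tito, of a k "a + int n * k"] by simp
      with 312[OF that k] show ?thesis .
    qed
    then have "order_of (\<lambda>_ _. True) = r"
      by (intro order_of_inversions is_tito_linear_order[OF tito]) auto
    then show "r \<in> {?D}" by simp
  next
    fix r assume "r \<in> {?D}"
    moreover have tito: "is_tito n ?D"
      by (rule is_tito_order_of) auto
    ultimately show "r \<in> avoiders {[3,1,2], [1,2,3]} n"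
      unfolding avoiders_pair using avoids_tito[OF tito] by (simp add: inversion_order_of del: One_nat_def)
  qed
  then show ?thesis by (simp add: counted_by_def)
qed

text \<open>
  If \<open>(x, y)\<close> is an inversion, avoiding 132 allows \<open>x\<close> to be decreased and avoiding 312 allows \<open>y\<close> to be
  decreased. Starting from a translate far to the right, every pair is reached. So either all pairs
  are inversions or none is.
\<close>
lemma counted_by_312_132: "counted_by {[3,1,2], [1,3,2]} (\<lambda>_. 2)"
proof -
  let ?D = "order_of (\<lambda>_ _. True)" and ?A = "order_of (\<lambda>_ _. False)"
  have "avoiders {[3,1,2], [1,3,2]} n = {?A, ?D}" if n: "n \<ge> 1" for n
  proof (intro equalityI subsetI)
    fix r assume "r \<in> avoiders {[3,1,2], [1,3,2]} n"
    then have tito: "is_tito n r" and "avoids r [3,1,2]" "avoids r [1,3,2]"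
      by (simp_all add: avoiders_pair)
    then have 312: "\<And>a b c. a < b \<Longrightarrow> b < c \<Longrightarrow> inversion r a c \<Longrightarrow> inversion r a b"
      and 132: "\<And>a b c. a < b \<Longrightarrow> b < c \<Longrightarrow> inversion r b c \<Longrightarrow> inversion r a c"
      unfolding avoids_tito[OF tito] by blast+
    have spread: "inversion r a b" if "inversion r x y" "a < b" for a b x y
    proof -
      obtain k where k: "x + int n * k > b"
        using exists_shift_above[OF n] by blast
      have less: "x + int n * k < y + int n * k"
        using that(1) by (simp add: inversion_def)
      have "inversion r (x + int n * k) (y + int n * k)"
        using that(1) by (simp add: inversion_shift[OF tito])
      then have "inversion r a (y + int n * k)"
        using k that(2) less by (intro 132[of a "x + int n * k"]) auto
      with 312[of a b "y + int n * k"] show ?thesis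
        using k that(2) less by simp
    qed
    have "?D = r \<or> ?A = r"
    proof (cases "\<exists>x y. inversion r x y")
      case True
      then have "?D = r"
        using spread by (intro order_of_inversions is_tito_linear_order[OF tito]) auto
      then show ?thesis ..
    next
      case False
      then have "?A = r"
        by (intro order_of_inversions is_tito_linear_order[OF tito]) auto
      then show ?thesis ..
    qed
    then show "r \<in> {?A, ?D}" by auto
  next
    fix r assume "r \<in> {?A, ?D}"
    moreover have titoA: "is_tito n ?A" and titoD: "is_tito n ?D"
      by (rule is_tito_order_of; simp)+
    ultimately show "r \<in> avoiders {[3,1,2], [1,3,2]} n"
      unfolding avoiders_pair using avoids_tito[OF titoA] avoids_tito[OF titoD]
      by (auto simp add: inversion_order_of simp del: One_nat_def)
  qed
  moreover have "(0, 1) \<in> ?A" "(0, 1) \<notin> ?D"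
    by (simp_all add: order_of_def)
  then have "?A \<noteq> ?D" by metis
  ultimately show ?thesis by (simp add: counted_by_def)
qed

section \<open>Avoiders determined by their descents\<close>

text \<open>
  Avoiding 312 and 213 makes \<open>I a b\<close> and \<open>I a c\<close> equivalent for \<open>a < b < c\<close>: every integer comes before all
  greater ones or after all greater ones, and the choice is free for each residue. The order lists
  the integers that are no descents increasingly, followed by the descents in decreasing order.
\<close>
lemma counted_by_312_213: "counted_by {[3,1,2], [2,1,3]} (\<lambda>n. 2 ^ n)"
proof (rule counted_by_periodic_sets[where F = "\<lambda>S. order_of (\<lambda>a b. a \<in> S)"])
  fix n S assume "S \<in> periodic_sets n"
  then have tito: "is_tito n (order_of (\<lambda>a b. a \<in> S))"
    by (intro is_tito_order_of) (auto simp: periodic_sets_def)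
  then show "order_of (\<lambda>a b. a \<in> S) \<in> avoiders {[3,1,2], [2,1,3]} n"
    unfolding avoiders_pair avoids_tito[OF tito] inversion_order_of by auto
next
  show "descents (order_of (\<lambda>a b. a \<in> S)) = S" for S
    by (simp add: descents_def inversion_order_of)
next
  fix n r assume "r \<in> avoiders {[3,1,2], [2,1,3]} n"
  then have tito: "is_tito n r" and "avoids r [3,1,2]" "avoids r [2,1,3]"
    by (simp_all add: avoiders_pair)
  then have 312: "\<And>a b c. a < b \<Longrightarrow> b < c \<Longrightarrow> inversion r a c \<Longrightarrow> inversion r a b"
    and 213: "\<And>a b c. a < b \<Longrightarrow> b < c \<Longrightarrow> inversion r a b \<Longrightarrow> inversion r a c"
    unfolding avoids_tito[OF tito] by blast+
  have "inversion r a b \<longleftrightarrow> a \<in> descents r" if "a < b" for a b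
    using 312[of a "a + 1" b] 213[of a "a + 1" b] that
    by (cases "b = a + 1") (auto simp: descents_def)
  then show "order_of (\<lambda>a b. a \<in> descents r) = r"
    by (intro order_of_inversions is_tito_linear_order[OF tito])
qed

text \<open>
  Avoiding 312 and 231 lets an inversion \<open>(a, b)\<close> be shrunk from both sides, down to each pair of
  neighbours in between; conversely, inversions of neighbours compose by transitivity. These are the
  layered orders: increasing sequences of decreasing runs.
\<close>
lemma counted_by_312_231: "counted_by {[3,1,2], [2,3,1]} (\<lambda>n. 2 ^ n)"
proof (rule counted_by_periodic_sets[where F = "\<lambda>S. order_of (\<lambda>a b. {a..<b} \<subseteq> S)"])
  fix n S assume S: "S \<in> periodic_sets n"
  have shift: "{a + int n..<b + int n} \<subseteq> S \<longleftrightarrow> {a..<b} \<subseteq> S" for a b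
  proof -
    have "{a + int n..<b + int n} = (\<lambda>x. x + int n) ` {a..<b}" by simp
    then show ?thesis
      using S by (auto simp: periodic_sets_def simp del: image_add_atLeastLessThan')
  qed
  have tito: "is_tito n (order_of (\<lambda>a b. {a..<b} \<subseteq> S))"
  proof (rule is_tito_order_of)
    fix a b c :: int
    assume "a < b" "b < c"
    then have "{a..<c} = {a..<b} \<union> {b..<c}" by auto
    then show "{a..<b} \<subseteq> S \<Longrightarrow> {b..<c} \<subseteq> S \<Longrightarrow> {a..<c} \<subseteq> S"
      and "{a..<c} \<subseteq> S \<Longrightarrow> {a..<b} \<subseteq> S \<or> {b..<c} \<subseteq> S"
      by auto
  qed (rule shift)
  then show "order_of (\<lambda>a b. {a..<b} \<subseteq> S) \<in> avoiders {[3,1,2], [2,3,1]} n"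
    unfolding avoiders_pair avoids_tito[OF tito] inversion_order_of by auto
next
  have "{a..<a + 1} = {a}" for a :: int by auto
  then show "descents (order_of (\<lambda>a b. {a..<b} \<subseteq> S)) = S" for S
    by (simp add: descents_def inversion_order_of)
next
  fix n r assume "r \<in> avoiders {[3,1,2], [2,3,1]} n"
  then have tito: "is_tito n r" and "avoids r [3,1,2]" "avoids r [2,3,1]"
    by (simp_all add: avoiders_pair)
  then have 312: "\<And>a b c. a < b \<Longrightarrow> b < c \<Longrightarrow> inversion r a c \<Longrightarrow> inversion r a b"
    and 231: "\<And>a b c. a < b \<Longrightarrow> b < c \<Longrightarrow> inversion r a c \<Longrightarrow> inversion r b c"
    unfolding avoids_tito[OF tito] by blast+
  have "inversion r a b \<longleftrightarrow> {a..<b} \<subseteq> descents r" if "a < b" for a b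
  proof
    assume I: "inversion r a b"
    show "{a..<b} \<subseteq> descents r"
    proof
      fix i assume i: "i \<in> {a..<b}"
      \<comment> \<open>First the left end is raised to \<open>i\<close>, then the right end is lowered to \<open>i + 1\<close>.\<close>
      have "inversion r i b"
        using I 231[of a i b] i by (cases "i = a") auto
      then have "inversion r i (i + 1)"
        using 312[of i "i + 1" b] i by (cases "i + 1 = b") auto
      then show "i \<in> descents r" by (simp add: descents_def)
    qed
  next
    assume "{a..<b} \<subseteq> descents r"
    with that show "inversion r a b"
    proof (induction b rule: int_gr_induct)
      case base
      then show ?case by (auto simp: descents_def)
    next
      case (step i)
      then have "{a..<i} \<subseteq> descents r" "i \<in> descents r"
        by auto
      then have "inversion r a i" "inversion r i (i + 1)"
        using step.IH by (auto simp: descents_def)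
      then show ?case
        by (rule inversion_trans[OF is_tito_linear_order[OF tito]])
    qed
  qed
  then show "order_of (\<lambda>a b. {a..<b} \<subseteq> descents r) = r"
    by (intro order_of_inversions is_tito_linear_order[OF tito])
qed

section \<open>Avoiders determined by their records\<close>

definition records :: "int rel \<Rightarrow> int set" where
  "records r = {b. \<forall>a. \<not> inversion r a b}"

text \<open>
  The elements of \<open>T\<close> cut the integers into intervals; an interval \<open>m, \<dots>, M\<close> that starts with \<open>m \<in> T\<close> is
  arranged as \<open>m + 1, \<dots>, M, m\<close>, and the intervals follow each other increasingly. The empty set
  would give the increasing order, which also belongs to the set of all integers; hence only nonempty
  sets are used as parameters.
\<close>
definition cyclic_block_order :: "int set \<Rightarrow> int rel" where
  "cyclic_block_order T = order_of (\<lambda>a b. a \<in> T \<and> {a<..b} \<inter> T = {})"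

lemma greatest_below:
  assumes "n \<ge> 1" "T \<in> periodic_sets n" "T \<noteq> {}" "b \<notin> T"
  obtains a where "a < b" "a \<in> T" "{a<..b} \<inter> T = {}"
proof -
  obtain t where t: "t \<in> T" using assms(3) by blast
  obtain k where k: "b + int n * k > t"
    using exists_shift_above[OF assms(1)] by blast
  \<comment> \<open>Moving \<open>t\<close> to the left by \<open>n k\<close> puts it below \<open>b\<close>, so the set of candidates is nonempty.\<close>
  let ?M = "{t - int n * k..<b} \<inter> T"
  have fin: "finite ?M" by simp
  have "t - int n * k \<in> T"
    using periodic_shift[OF assms(2), of t "- k"] t by simp
  with k have "t - int n * k \<in> ?M" by simp
  then have "?M \<noteq> {}" by blast
  from Max_in[OF fin this] have M: "Max ?M \<in> ?M" .
  have "{Max ?M<..b} \<inter> T = {}"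
  proof (rule equals0I)
    fix c assume c: "c \<in> {Max ?M<..b} \<inter> T"
    with assms(4) have "c \<noteq> b" by blast
    with c M have "c \<in> ?M" by auto
    from Max_ge[OF fin this] c show False by simp
  qed
  with M show ?thesis by (intro that[of "Max ?M"]) auto
qed

lemma records_cyclic_block_order:
  assumes "n \<ge> 1" "T \<in> periodic_sets n" "T \<noteq> {}"
  shows "records (cyclic_block_order T) = T"
proof (intro equalityI subsetI)
  fix b assume "b \<in> records (cyclic_block_order T)"
  then show "b \<in> T"
    using greatest_below[OF assms, of b]
    by (auto simp: records_def cyclic_block_order_def inversion_order_of)
next
  fix b assume "b \<in> T"
  then show "b \<in> records (cyclic_block_order T)"
    by (auto simp: records_def cyclic_block_order_def inversion_order_of)
qed

lemma cyclic_block_order_avoids: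
  assumes T: "T \<in> periodic_sets n"
  shows "cyclic_block_order T \<in> avoiders {[3,1,2], [3,2,1]} n"
proof -
  have shift: "{a + int n<..b + int n} \<inter> T = {} \<longleftrightarrow> {a<..b} \<inter> T = {}" for a b
  proof -
    have "{a + int n<..b + int n} \<inter> T = (\<lambda>x. x + int n) ` ({a<..b} \<inter> T)"
    proof (intro equalityI subsetI)
      fix x assume "x \<in> {a + int n<..b + int n} \<inter> T"
      then show "x \<in> (\<lambda>x. x + int n) ` ({a<..b} \<inter> T)"
        using periodic_shift[OF T, of "x - int n" 1] by (intro image_eqI[of _ _ "x - int n"]) auto
    qed (use T in \<open>auto simp: periodic_sets_def\<close>)
    then show ?thesis by simp
  qed
  have tito: "is_tito n (cyclic_block_order T)"
    unfolding cyclic_block_order_def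
  proof (rule is_tito_order_of)
    show "a + int n \<in> T \<and> {a + int n<..b + int n} \<inter> T = {} \<longleftrightarrow> a \<in> T \<and> {a<..b} \<inter> T = {}" for a b
      using T shift by (simp add: periodic_sets_def)
  qed (auto simp: disjoint_iff)
  then show ?thesis
    unfolding avoiders_pair avoids_tito[OF tito]
    by (auto simp: cyclic_block_order_def inversion_order_of disjoint_iff)
qed

text \<open>
  Avoiding 321 says that the smaller element of an inversion is never the greater element of another
  one, so it is a record. If \<open>(a, b)\<close> is an inversion, 312 makes all \<open>(a, c)\<close> with \<open>a < c \<le> b\<close> inversions, so
  there is no record in between. Conversely, if \<open>a\<close> is the last record up to \<open>b\<close> and \<open>b\<close> is none, some
  \<open>(g, b)\<close> is an inversion, and what has been shown leaves only \<open>g = a\<close>.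
\<close>
lemma avoider_312_321_eq_cyclic_block_order:
  assumes "r \<in> avoiders {[3,1,2], [3,2,1]} n"
  shows "records r \<in> periodic_sets n" "records r \<noteq> {}" "cyclic_block_order (records r) = r"
proof -
  have tito: "is_tito n r" and "avoids r [3,1,2]" "avoids r [3,2,1]"
    using assms by (simp_all add: avoiders_pair)
  then have 312: "\<And>a b c. a < b \<Longrightarrow> b < c \<Longrightarrow> inversion r a c \<Longrightarrow> inversion r a b"
    and 321: "\<And>a b c. a < b \<Longrightarrow> b < c \<Longrightarrow> inversion r a b \<Longrightarrow> \<not> inversion r b c"
    unfolding avoids_tito[OF tito] by blast+
  have less: "a < b" if "inversion r a b" for a b
    using that by (simp add: inversion_def)
  have left: "a \<in> records r" if "inversion r a b" for a b
    using 321[OF less less[OF that]] that by (auto simp: records_def)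
  have "a + int n \<in> records r \<longleftrightarrow> a \<in> records r" for a
  proof -
    have "(\<forall>x. \<not> inversion r x (a + int n)) \<longleftrightarrow> (\<forall>x. \<not> inversion r (x + int n) (a + int n))"
      by (metis diff_add_cancel)
    then show ?thesis
      by (simp add: records_def inversion_translate[OF tito])
  qed
  then show "records r \<in> periodic_sets n" by (simp add: periodic_sets_def)
  \<comment> \<open>The smaller element of an inversion is a record; without inversions every integer is one.\<close>
  show "records r \<noteq> {}"
  proof (cases "\<exists>a b. inversion r a b")
    case True
    with left show ?thesis by blast
  next
    case False
    then have "0 \<in> records r" by (simp add: records_def)
    then show ?thesis by blast
  qed
  have only_if: "a \<in> records r \<and> {a<..b} \<inter> records r = {}" if "inversion r a b" for a b
  proof -
    have "c \<notin> records r" if "a < c" "c \<le> b" for c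
      using 312[of a c b] that \<open>inversion r a b\<close> by (cases "c = b") (auto simp: records_def)
    with left[OF that] show ?thesis by auto
  qed
  have "inversion r a b"
    if "a < b" and a: "a \<in> records r" and empty: "{a<..b} \<inter> records r = {}" for a b
  proof -
    have "b \<notin> records r" using that by auto
    then obtain g where g: "inversion r g b" by (auto simp: records_def)
    have "\<not> a < g" using left[OF g] empty less[OF g] by (auto simp: disjoint_iff)
    moreover have "\<not> g < a" using only_if[OF g] a \<open>a < b\<close> by (auto simp: disjoint_iff)
    ultimately show ?thesis using g by simp
  qed
  with only_if show "cyclic_block_order (records r) = r"
    unfolding cyclic_block_order_def
    by (intro order_of_inversions is_tito_linear_order[OF tito]) blast
qed

lemma counted_by_312_321: "counted_by {[3,1,2], [3,2,1]} (\<lambda>n. 2 ^ n - 1)"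
  unfolding counted_by_def
proof (intro allI impI)
  fix n :: nat assume n: "n \<ge> 1"
  have "bij_betw cyclic_block_order (periodic_sets n - {{}}) (avoiders {[3,1,2], [3,2,1]} n)"
  proof (rule bij_betw_byWitness[where f' = records])
    show "\<forall>T\<in>periodic_sets n - {{}}. records (cyclic_block_order T) = T"
      using records_cyclic_block_order[OF n] by simp
    show "\<forall>r\<in>avoiders {[3,1,2], [3,2,1]} n. cyclic_block_order (records r) = r"
      using avoider_312_321_eq_cyclic_block_order(3) by (intro ballI)
    show "cyclic_block_order ` (periodic_sets n - {{}}) \<subseteq> avoiders {[3,1,2], [3,2,1]} n"
      by (intro image_subsetI cyclic_block_order_avoids) simp
    show "records ` avoiders {[3,1,2], [3,2,1]} n \<subseteq> periodic_sets n - {{}}"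
      by (intro image_subsetI DiffI) (simp_all add: avoider_312_321_eq_cyclic_block_order del: One_nat_def)
  qed
  note bij_betw_finite[OF this] bij_betw_same_card[OF this]
  moreover have "{} \<in> periodic_sets n" by (simp add: periodic_sets_def)
  then have "finite (periodic_sets n - {{}})" "card (periodic_sets n - {{}}) = 2 ^ n - 1"
    using card_periodic_sets[OF n] by auto
  ultimately show "finite (avoiders {[3,1,2], [3,2,1]} n) \<and> card (avoiders {[3,1,2], [3,2,1]} n) = 2 ^ n - 1"
    by simp
qed

section \<open>Generating functions\<close>

lemma fps_eq_divide_if_mult:
  fixes F :: "'a :: field fps"
  assumes "F * G = H" "fps_nth G 0 \<noteq> 0"
  shows "F = H / G"
proof -
  from assms(2) have "G \<noteq> 0" by auto
  with assms(1) show ?thesis by auto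
qed

lemma gf_avoiding_eq_Abs_fps:
  assumes "\<forall>n\<ge>1. num_avoiding p q n = f n"
  shows "gf_avoiding p q = Abs_fps (\<lambda>n. if n = 0 then 0 else of_nat (f n))"
  using assms by (auto simp: gf_avoiding_def fps_eq_iff num_avoiding_def)

lemma geometric_fps:
  "Abs_fps (\<lambda>n. if n = 0 then 0 else c ^ n) * (1 - fps_const c * fps_X) = fps_const (c :: rat) * fps_X"
proof (rule fps_ext)
  fix n
  show "fps_nth (Abs_fps (\<lambda>n. if n = 0 then 0 else c ^ n) * (1 - fps_const c * fps_X)) n =
      fps_nth (fps_const c * fps_X) n"
    by (cases n) (auto simp: right_diff_distrib mult.left_commute[of _ "fps_const c"])
qed

lemma gf_powers_of_two:
  assumes "\<forall>n\<ge>1. num_avoiding p q n = 2 ^ n"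
  shows "gf_avoiding p q = 2 * fps_X / (1 - 2 * fps_X)"
proof (rule fps_eq_divide_if_mult)
  have "gf_avoiding p q = Abs_fps (\<lambda>n. if n = 0 then 0 else 2 ^ n)"
    by (auto simp: gf_avoiding_eq_Abs_fps[OF assms] fps_eq_iff)
  then show "gf_avoiding p q * (1 - 2 * fps_X) = 2 * fps_X"
    using geometric_fps[of 2] by (simp add: numeral_fps_const)
qed simp

lemma gf_const:
  assumes "\<forall>n\<ge>1. num_avoiding p q n = c"
  shows "gf_avoiding p q = of_nat c * fps_X / (1 - fps_X)"
proof (rule fps_eq_divide_if_mult)
  have "gf_avoiding p q = fps_const (of_nat c) * Abs_fps (\<lambda>n. if n = 0 then 0 else 1 ^ n)"
    by (auto simp: gf_avoiding_eq_Abs_fps[OF assms] fps_eq_iff)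
  then show "gf_avoiding p q * (1 - fps_X) = of_nat c * fps_X"
    using geometric_fps[of 1] by (simp add: mult.assoc fps_of_nat)
qed simp

lemma gf_powers_of_two_minus_one:
  assumes "\<forall>n\<ge>1. num_avoiding p q n = 2 ^ n - 1"
  shows "gf_avoiding p q = fps_X / ((1 - 2 * fps_X) * (1 - fps_X))"
proof (rule fps_eq_divide_if_mult)
  let ?A = "Abs_fps (\<lambda>n. if n = 0 then 0 else 2 ^ n) :: rat fps"
  let ?B = "Abs_fps (\<lambda>n. if n = 0 then 0 else 1 ^ n) :: rat fps"
  have "gf_avoiding p q = ?A - ?B"
    by (auto simp: gf_avoiding_eq_Abs_fps[OF assms] fps_eq_iff of_nat_diff)
  moreover have "?A * (1 - 2 * fps_X) = 2 * fps_X" "?B * (1 - fps_X) = fps_X"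
    using geometric_fps[of 2] geometric_fps[of 1] by (simp_all add: numeral_fps_const)
  ultimately show "gf_avoiding p q * ((1 - 2 * fps_X) * (1 - fps_X)) = fps_X"
    by algebra
qed simp

section \<open>The fifteen pairs of patterns\<close>

lemma counted_by_avoiding_titos:
  assumes "counted_by {p, q} f"
  shows "\<forall>n\<ge>1. finite (avoiding_titos p q n)" "\<forall>n\<ge>1. num_avoiding p q n = f n"
proof -
  have "avoiding_titos p q n = avoiders {p, q} n" for n
    by (auto simp: avoiding_titos_def avoiders_def)
  with assms show "\<forall>n\<ge>1. finite (avoiding_titos p q n)" "\<forall>n\<ge>1. num_avoiding p q n = f n"
    by (auto simp: counted_by_def num_avoiding_def)
qed

lemma complement_length_3:
  "complement [a, b, c] = [4 - a, 4 - b, 4 - c]"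
  by (simp add: complement_def eval_nat_numeral)

lemma counted_by_orbit:
  assumes "counted_by {p, q} f" "set p \<subseteq> {1..length p}" "set q \<subseteq> {1..length q}"
  shows "counted_by {rev p, rev q} f" "counted_by {complement p, complement q} f"
    "counted_by {rev (complement p), rev (complement q)} f"
proof -
  have compl: "counted_by (complement ` {p, q}) f"
    by (rule counted_by_complement[OF assms(1)]) (use assms(2,3) in auto)
  from counted_by_rev[OF assms(1)] compl counted_by_rev[OF compl]
  show "counted_by {rev p, rev q} f" "counted_by {complement p, complement q} f"
    "counted_by {rev (complement p), rev (complement q)} f" by simp_all
qed

lemma counted_by_class_a:
  "P \<in> {{[3,1,2], [1,2,3]}, {[2,1,3], [3,2,1]}, {[1,3,2], [3,2,1]}, {[2,3,1], [1,2,3]}} \<Longrightarrow>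
    counted_by P (\<lambda>_. 1)"
  using counted_by_312_123 counted_by_orbit[OF counted_by_312_123]
  by (auto simp: complement_length_3)

lemma counted_by_class_b:
  "P \<in> {{[3,1,2], [1,3,2]}, {[2,1,3], [2,3,1]}} \<Longrightarrow> counted_by P (\<lambda>_. 2)"
  using counted_by_312_132 counted_by_orbit[OF counted_by_312_132]
  by (auto simp: complement_length_3)

lemma counted_by_class_c:
  "P \<in> {{[3,1,2], [2,3,1]}, {[2,1,3], [1,3,2]}, {[3,1,2], [2,1,3]}, {[1,3,2], [2,3,1]}} \<Longrightarrow>
    counted_by P (\<lambda>n. 2 ^ n)"
  using counted_by_312_231 counted_by_orbit[OF counted_by_312_231]
    counted_by_312_213 counted_by_orbit[OF counted_by_312_213]
  by (auto simp: complement_length_3)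

lemma counted_by_class_d:
  "P \<in> {{[3,1,2], [3,2,1]}, {[2,1,3], [1,2,3]}, {[1,3,2], [1,2,3]}, {[2,3,1], [3,2,1]}} \<Longrightarrow>
    counted_by P (\<lambda>n. 2 ^ n - 1)"
  using counted_by_312_321 counted_by_orbit[OF counted_by_312_321]
  by (auto simp: complement_length_3)

lemma permutations_of_three:
  assumes "p \<in> permutations_of_set {1..3::nat}"
  shows "p \<in> {[1,2,3], [1,3,2], [2,1,3], [2,3,1], [3,1,2], [3,2,1]}"
proof -
  have "{1..3} = {1, 2, 3::nat}" by auto
  with permutations_of_setD[OF assms] have p: "set p = {1, 2, 3}" "distinct p"
    by (simp_all only:)
  then have "length p = 3"
    using distinct_card[of p] by simp
  then obtain x y z where xyz: "p = [x, y, z]"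
    by (auto simp: numeral_3_eq_3 length_Suc_conv)
  have "set p \<subseteq> {1, 2, 3}" using p(1) by simp
  then have "x \<in> {1, 2, 3}" "y \<in> {1, 2, 3}" "z \<in> {1, 2, 3}"
    unfolding xyz by simp_all
  moreover have "x \<noteq> y" "x \<noteq> z" "y \<noteq> z"
    using p(2) unfolding xyz by simp_all
  ultimately show ?thesis
    unfolding xyz by (elim insertE emptyE) simp_all
qed

theorem theorem1p1:
  fixes p q :: "nat list"
  assumes "p \<in> permutations_of_set {1..3}"
    and "q \<in> permutations_of_set {1..3}"
    and "p \<noteq> q"
  shows "(\<forall>n\<ge>1. finite (avoiding_titos p q n)) \<and>
    ({p, q} \<in> {{[3,1,2], [1,2,3]}, {[2,1,3], [3,2,1]}, {[1,3,2], [3,2,1]}, {[2,3,1], [1,2,3]}} \<longrightarrow>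
           (\<forall>n\<ge>1. num_avoiding p q n = 1) \<and>
           gf_avoiding p q = fps_X / (1 - fps_X)) \<and>
    ({p, q} \<in> {{[3,1,2], [1,3,2]}, {[2,1,3], [2,3,1]}} \<longrightarrow>
           (\<forall>n\<ge>1. num_avoiding p q n = 2) \<and>
           gf_avoiding p q = 2 * fps_X / (1 - fps_X)) \<and>
    ({p, q} \<in> {{[3,1,2], [2,3,1]}, {[2,1,3], [1,3,2]}, {[3,1,2], [2,1,3]}, {[1,3,2], [2,3,1]}} \<longrightarrow>
           (\<forall>n\<ge>1. num_avoiding p q n = 2 ^ n) \<and>
           gf_avoiding p q = 2 * fps_X / (1 - 2 * fps_X)) \<and>
    ({p, q} \<in> {{[3,1,2], [3,2,1]}, {[2,1,3], [1,2,3]}, {[1,3,2], [1,2,3]}, {[2,3,1], [3,2,1]}} \<longrightarrow>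
           (\<forall>n\<ge>1. num_avoiding p q n = 2 ^ n - 1) \<and>
           gf_avoiding p q = fps_X / ((1 - 2 * fps_X) * (1 - fps_X))) \<and>
    ({p, q} = {[1,2,3], [3,2,1]} \<longrightarrow>
           (\<forall>n\<ge>1. num_avoiding p q n = 0) \<and>
           gf_avoiding p q = 0)"
proof -
  define A B C D :: "nat list set set"
    where "A = {{[3,1,2], [1,2,3]}, {[2,1,3], [3,2,1]}, {[1,3,2], [3,2,1]}, {[2,3,1], [1,2,3]}}"
      and "B = {{[3,1,2], [1,3,2]}, {[2,1,3], [2,3,1]}}"
      and "C = {{[3,1,2], [2,3,1]}, {[2,1,3], [1,3,2]}, {[3,1,2], [2,1,3]}, {[1,3,2], [2,3,1]}}"
      and "D = {{[3,1,2], [3,2,1]}, {[2,1,3], [1,2,3]}, {[1,3,2], [1,2,3]}, {[2,3,1], [3,2,1]}}"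
  note classes = A_def B_def C_def D_def
  have a: "counted_by {p, q} (\<lambda>_. 1)" if "{p, q} \<in> A"
    by (rule counted_by_class_a[OF that[unfolded A_def]])
  have b: "counted_by {p, q} (\<lambda>_. 2)" if "{p, q} \<in> B"
    by (rule counted_by_class_b[OF that[unfolded B_def]])
  have c: "counted_by {p, q} (\<lambda>n. 2 ^ n)" if "{p, q} \<in> C"
    by (rule counted_by_class_c[OF that[unfolded C_def]])
  have d: "counted_by {p, q} (\<lambda>n. 2 ^ n - 1)" if "{p, q} \<in> D"
    by (rule counted_by_class_d[OF that[unfolded D_def]])
  have e: "counted_by {p, q} (\<lambda>_. 0)" if "{p, q} = {[1,2,3], [3,2,1]}"
    unfolding that by (rule counted_by_123_321)
  have "{p, q} \<in> A \<or> {p, q} \<in> B \<or> {p, q} \<in> C \<or> {p, q} \<in> D \<or> {p, q} = {[1,2,3], [3,2,1]}"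
    using permutations_of_three[OF assms(1)] permutations_of_three[OF assms(2)] assms(3)
    unfolding classes by (elim insertE emptyE; simp add: doubleton_eq_iff)
  then have "\<forall>n\<ge>1. finite (avoiding_titos p q n)"
    using a b c d e counted_by_avoiding_titos(1) by metis
  moreover have "{p, q} \<in> A \<longrightarrow> (\<forall>n\<ge>1. num_avoiding p q n = 1) \<and>
      gf_avoiding p q = fps_X / (1 - fps_X)"
    using counted_by_avoiding_titos(2)[OF a] gf_const[of p q 1] by simp
  moreover have "{p, q} \<in> B \<longrightarrow> (\<forall>n\<ge>1. num_avoiding p q n = 2) \<and>
      gf_avoiding p q = 2 * fps_X / (1 - fps_X)"
    using counted_by_avoiding_titos(2)[OF b] gf_const[of p q 2] by simp
  moreover have "{p, q} \<in> C \<longrightarrow> (\<forall>n\<ge>1. num_avoiding p q n = 2 ^ n) \<and>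
      gf_avoiding p q = 2 * fps_X / (1 - 2 * fps_X)"
    using counted_by_avoiding_titos(2)[OF c] gf_powers_of_two[of p q] by simp
  moreover have "{p, q} \<in> D \<longrightarrow> (\<forall>n\<ge>1. num_avoiding p q n = 2 ^ n - 1) \<and>
      gf_avoiding p q = fps_X / ((1 - 2 * fps_X) * (1 - fps_X))"
    using counted_by_avoiding_titos(2)[OF d] gf_powers_of_two_minus_one[of p q] by simp
  moreover have "{p, q} = {[1,2,3], [3,2,1]} \<longrightarrow> (\<forall>n\<ge>1. num_avoiding p q n = 0) \<and>
      gf_avoiding p q = 0"
    using counted_by_avoiding_titos(2)[OF e] gf_const[of p q 0] by simp
  ultimately show ?thesis
    unfolding classes by (intro conjI)
qed
end
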